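(* Let $b>1$ be an integer, let $A\subset\{0,1,\dots,b-1\}$ be neither empty nor equal to $\{0\}$, let $N=\#A$, and let $s\in\mathbb{C}$ with $\Re s>\log_b(N)$. Let $K_{b,A,s}=\sum'_{n>0}n^{-s}$, where the prime means that only $A$-admissible integers $n$ are kept in the sum. Let $\ell\ge1$ be an integer. Then $$K_{b,A,s}={\sum_{0<n<b^{\ell-1}}}'\frac{1}{n^s}+\frac{b^s}{b^s-N}{\sum_{b^{\ell-1}\le n<b^{\ell}}}'\frac{1}{n^s}+\sum_{m=1}^\infty(-1)^m\frac{(s)_m}{m!}\,u_{A,s}(m){\sum_{b^{\ell-1}\le n<b^{\ell}}}'\frac{1}{n^{m+s}},$$ where the series over $m$ converges. For $s$ real, the partial sums (truncations of the series over $m$, together with the terms preceding it) provide lower and upper bounds of $K_{b,A,s}$, depending on the parity of the number of terms. For complex $s$, if either $\ell>1$, or $\ell=1$ and $1\notin A$, or $\ell=1$ and $b-1\notin A$, the series over $m$ is geometrically convergent.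
   Context: Let $\mathcal{W}$ be the set of all finite words (including the empty word $\epsilon$) on the alphabet $\{0,1,\dots,b-1\}$; $\ell(w)$ denotes the length of $w$. For $w=d_1\dots d_l$ put $n(w)=d_1b^{l-1}+\dots+d_l$ (with $n(\epsilon)=0$) and $x(w)=n(w)/b^{\ell(w)}\in[0,1)$. The elements of $A$ are the admissible digits; a word is ($A$-)admissible if all its digits are in $A$ (the empty word is admissible). A non-negative integer is ($A$-)admissible if its minimal-length base-$b$ representation is an admissible word ($0$ has the empty word as minimal representation and so is always admissible). The complex measure $\mu_{A,s}$ on $\mathcal{W}$ gives mass $b^{-s\ell(w)}$ to each admissible word $w$ and mass $0$ to non-admissible words; it is a finite complex measure as $\Re s>\log_b(N)$. Its moments are $u_{A,s}(m)=\int_{\mathcal{W}}x(w)^m\,d\mu_{A,s}(w)=\sum_{w\text{ admissible}}b^{-s\ell(w)}x(w)^m$ for integers $m\ge0$, with $x(w)^0=1$. The Pochhammer symbol is $(s)_m=s(s+1)\cdots(s+m-1)$, $(s)_0=1$. "Geometrically convergent" means that the remainders are $O(c^m)$ for some $0<c<1$. *)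

theory Defs
  imports "HOL-Analysis.Analysis" "HOL-Library.Landau_Symbols"
begin

definition words :: "nat \<Rightarrow> nat list set" where
  "words b = lists {0..<b}"

text \<open>Words are written most significant digit first.\<close>

definition word_num :: "nat \<Rightarrow> nat list \<Rightarrow> nat" where
  "word_num b w = (\<Sum>i<length w. w ! i * b ^ (length w - 1 - i))"

definition word_frac :: "nat \<Rightarrow> nat list \<Rightarrow> real" where
  "word_frac b w = real (word_num b w) / real b ^ length w"

definition admissible_word :: "nat set \<Rightarrow> nat list \<Rightarrow> bool" where
  "admissible_word A w \<longleftrightarrow> set w \<subseteq> A"

definition minimal_rep :: "nat \<Rightarrow> nat list \<Rightarrow> nat \<Rightarrow> bool" where
  "minimal_rep b w n \<longleftrightarrow>
     w \<in> words b \<and> word_num b w = n \<and>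
     (\<forall>v\<in>words b. word_num b v = n \<longrightarrow> length w \<le> length v)"

definition admissible_nat :: "nat \<Rightarrow> nat set \<Rightarrow> nat \<Rightarrow> bool" where
  "admissible_nat b A n \<longleftrightarrow> (\<exists>w. minimal_rep b w n \<and> admissible_word A w)"

definition restricted_zeta :: "nat \<Rightarrow> nat set \<Rightarrow> complex \<Rightarrow> complex" where
  "restricted_zeta b A s =
     (\<Sum>\<^sub>\<infinity>n\<in>{n. 0 < n \<and> admissible_nat b A n}. 1 / of_nat n powr s)"

text \<open>
  The complex measure on the countable discrete space of words is given by its point masses, and
  integration against it is unordered (absolutely convergent) summation.
\<close>

definition word_mass :: "nat \<Rightarrow> nat set \<Rightarrow> complex \<Rightarrow> nat list \<Rightarrow> complex" where
  "word_mass b A s w =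
     (if admissible_word A w then of_nat b powr (- s * of_nat (length w)) else 0)"

definition moment :: "nat \<Rightarrow> nat set \<Rightarrow> complex \<Rightarrow> nat \<Rightarrow> complex" where
  "moment b A s m =
     (\<Sum>\<^sub>\<infinity>w\<in>words b. of_real (word_frac b w) ^ m * word_mass b A s w)"

definition admissible_block :: "nat \<Rightarrow> nat set \<Rightarrow> nat \<Rightarrow> nat set" where
  "admissible_block b A l = {n. b ^ (l - 1) \<le> n \<and> n < b ^ l \<and> admissible_nat b A n}"

definition leading_terms :: "nat \<Rightarrow> nat set \<Rightarrow> complex \<Rightarrow> nat \<Rightarrow> complex" where
  "leading_terms b A s l =
     (\<Sum>n\<in>{n. 0 < n \<and> n < b ^ (l - 1) \<and> admissible_nat b A n}. 1 / of_nat n powr s) +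
     of_nat b powr s / (of_nat b powr s - of_nat (card A)) *
       (\<Sum>n\<in>admissible_block b A l. 1 / of_nat n powr s)"

definition series_term :: "nat \<Rightarrow> nat set \<Rightarrow> complex \<Rightarrow> nat \<Rightarrow> nat \<Rightarrow> complex" where
  "series_term b A s l m =
     (-1) ^ m * (pochhammer s m / fact m) * moment b A s m *
       (\<Sum>n\<in>admissible_block b A l. 1 / of_nat n powr (of_nat m + s))"

definition geometrically_convergent :: "(nat \<Rightarrow> complex) \<Rightarrow> bool" where
  "geometrically_convergent f \<longleftrightarrow>
     summable f \<and> (\<exists>c::real. 0 < c \<and> c < 1 \<and> (\<lambda>M. \<Sum>m. f (m + M)) \<in> O(\<lambda>M. of_real (c ^ M)))"

end

theory Submission
  imports Defs
begin

text \<open>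
  Every admissible integer \<open>n \<ge> b ^ (l - 1)\<close> is obtained in exactly one way from an admissible
  integer \<open>p\<close> with \<open>l\<close> digits by appending an admissible word \<open>w\<close>
  (\<open>block_append_inj\<close>, \<open>block_append_surj\<close>).  If \<open>k\<close> is the length of \<open>w\<close> and
  \<open>x\<close> its fraction, then \<open>n = b ^ k * p * (1 + x / p)\<close>.  Hence the sum of \<open>n powr (- s)\<close> over all
  \<open>w\<close> is \<open>p powr (- s)\<close> times the integral of \<open>(1 + x / p) powr (- s)\<close> against the measure on words.
  Expanding this power by the binomial series, whose coefficients \<open>(- s) gchoose m\<close> equal
  \<open>(- 1) ^ m * pochhammer s m / fact m\<close>, and integrating termwise gives the moments and the
  claimed series; its term for \<open>m = 0\<close> is the second leading term, because the total mass is
  \<open>b powr s / (b powr s - N)\<close> with \<open>N = card A\<close> (\<open>moment_0\<close>).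

  The expansion need not converge absolutely after integration when \<open>p = 1\<close> and \<open>b - 1\<close> is an
  admissible digit, for then \<open>x / p\<close> comes arbitrarily close to \<open>1\<close>.  The proof therefore never
  exchanges an infinite series with the integral.  For \<open>Re s \<ge> 0\<close> and \<open>y \<ge> 0\<close>, the remainder of the
  binomial series of \<open>(1 + y) powr (- s)\<close> is at most the norm of the first omitted term
  (\<open>powr_neg_binomial_remainder_le\<close>).  Integrating this bound yields a \<open>majorant\<close> for the remainder
  of the whole series (\<open>norm_remainder_le\<close>), from which the claims follow:

  \<^item> The series converges to the right value because the majorant tends to \<open>0\<close>.  The coefficients
    grow like \<open>m powr (Re s - 1)\<close>, and the moments for the exponent \<open>Re s\<close> are
    \<open>O(m powr (- r))\<close> for every \<open>r < Re s\<close> (\<open>real_moment_le_powr\<close>), by self-similarity of the measure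
    near \<open>x = 1\<close>.
  \<^item> For real \<open>s\<close> the terms alternate in sign and the majorant is the absolute value of a
    term.  Thus each remainder is at most as large as its first term, which forces the
    remainders to alternate as well (\<open>remainder_sign\<close>).
  \<^item> The convergence is geometric if \<open>x / p\<close> stays away from \<open>1\<close>.  This holds if \<open>p \<ge> 2\<close> for all
    blocks, that is, if \<open>l > 1\<close> or \<open>1\<close> is not admissible, and also if \<open>b - 1\<close> is not admissible,
    since then \<open>x \<le> 1 - 1 / b\<close>.
\<close>

section \<open>Admissible integers as a leading block followed by a word\<close>

lemma word_num_snoc: "word_num b (w @ [a]) = b * word_num b w + a"
proof -
  have *: "w ! i * b ^ (length w - i) = b * (w ! i * b ^ (length w - 1 - i))" if "i < length w" for i
  proof -
    have "length w - i = Suc (length w - 1 - i)"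
      using that by simp
    then show ?thesis by simp
  qed
  show ?thesis
    by (simp add: word_num_def nth_append sum_distrib_left * cong: sum.cong_simp)
qed

lemma word_num_Nil [simp]: "word_num b [] = 0"
  by (simp add: word_num_def)

lemma word_num_Cons: "word_num b (a # w) = a * b ^ length w + word_num b w"
  unfolding word_num_def by (simp add: sum.lessThan_Suc_shift del: sum.lessThan_Suc)

lemma words_snoc_iff [simp]: "w @ [a] \<in> words b \<longleftrightarrow> w \<in> words b \<and> a < b"
  by (auto simp: words_def)

lemma word_num_less:
  assumes "w \<in> words b"
  shows "word_num b w < b ^ length w"
  using assms
proof (induction w)
  case (Cons a w)
  have "word_num b w < b ^ length w" and "a < b"
    using Cons by (auto simp: words_def)
  then have "a * b ^ length w + word_num b w < (a + 1) * b ^ length w"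
    by simp
  also have "\<dots> \<le> b * b ^ length w"
    using \<open>a < b\<close> by (intro mult_right_mono) auto
  finally show ?case
    by (simp add: word_num_Cons)
qed auto

text \<open>
  Deleting the last digit of a minimal representation leaves a minimal one, and appending a digit
  to a minimal representation keeps it minimal unless the result represents \<open>0\<close>.  This recursion
  replaces all reasoning about leading zeros.
\<close>

lemma admissible_nat_div_mod:
  assumes b: "b > 1" and n: "n > 0"
  shows "admissible_nat b A n \<longleftrightarrow> n mod b \<in> A \<and> admissible_nat b A (n div b)"
proof -
  have snocE: "\<exists>v. w = v @ [n mod b] \<and> v \<in> words b \<and> word_num b v = n div b"
    if "w \<in> words b" "word_num b w = n" for w
  proof -
    have "w \<noteq> []"
      using that n by auto
    then obtain v a where w: "w = v @ [a]"
      by (metis rev_exhaust)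
    then have "a < b" "v \<in> words b"
      using that by auto
    then show ?thesis
      using that w by (auto simp: word_num_snoc)
  qed
  have snocI: "v @ [n mod b] \<in> words b \<and> word_num b (v @ [n mod b]) = n"
    if "v \<in> words b" "word_num b v = n div b" for v
    using that b by (simp add: word_num_snoc)
  have "minimal_rep b (v @ [n mod b]) n \<longleftrightarrow> minimal_rep b v (n div b)" for v
    unfolding minimal_rep_def
    by (smt (verit, ccfv_threshold) Suc_le_mono append_same_eq length_append_singleton snocE snocI)
  moreover have "\<exists>v. w = v @ [n mod b]" if "minimal_rep b w n" for w
    using that snocE unfolding minimal_rep_def by blast
  ultimately show ?thesis
    unfolding admissible_nat_def admissible_word_def
    by (metis (no_types, lifting) Un_subset_iff empty_subsetI insert_subset list.simps(15) list.set(1) set_append)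
qed

lemma admissible_nat_append:
  assumes b: "b > 1" and A: "A \<subseteq> {0..<b}" and p: "p > 0" "admissible_nat b A p" and w: "w \<in> lists A"
  shows "admissible_nat b A (p * b ^ length w + word_num b w)"
  using w
proof (induction w rule: rev_induct)
  case (snoc a w)
  let ?n = "p * b ^ length w + word_num b w"
  have n: "p * b ^ length (w @ [a]) + word_num b (w @ [a]) = b * ?n + a"
    by (simp add: word_num_snoc algebra_simps)
  have "a < b" "a \<in> A" "?n > 0"
    using snoc.prems A p b by auto
  then show ?case
    unfolding n using b snoc by (subst admissible_nat_div_mod) auto
qed (use p in simp)

lemma ge_block_append:
  assumes b: "b > 1" and p: "p \<ge> (B::nat)"
  shows "p * b ^ length w + word_num b w \<ge> B"
proof -
  have "B * 1 \<le> p * b ^ length w"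
    using b p by (intro mult_mono) auto
  then show ?thesis by simp
qed

text \<open>
  Comparing last digits peels off both words in parallel.  The words cannot run out at different
  times, because a block followed by at least one more digit is at least \<open>b ^ l\<close>.
\<close>

lemma block_append_inj:
  assumes b: "b > 1" and l: "l \<ge> 1" and A: "A \<subseteq> {0..<b}"
    and p: "p \<in> admissible_block b A l" and p': "p' \<in> admissible_block b A l"
    and "w \<in> lists A" "w' \<in> lists A"
    and "p * b ^ length w + word_num b w = p' * b ^ length w' + word_num b w'"
  shows "p = p' \<and> w = w'"
  using assms(6-8)
proof (induction w arbitrary: w' rule: rev_induct)
  have bl: "b ^ l = b * b ^ (l - 1)"
    using l by (cases l) auto
  have big: False
    if "q \<in> admissible_block b A l" "q' \<in> admissible_block b A l"
      "q' = q * b ^ length (w @ [a]) + word_num b (w @ [a])" for q q' w a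
  proof -
    have "b * b ^ (l - 1) \<le> b * (q * b ^ length w + word_num b w)"
      using ge_block_append[OF b, of "b ^ (l - 1)" q w] that(1)
      by (intro mult_left_mono) (auto simp: admissible_block_def)
    also have "\<dots> \<le> q'"
      using that(3) by (simp add: word_num_snoc algebra_simps)
    also have "\<dots> < b ^ l"
      using that(2) by (simp add: admissible_block_def)
    finally show False
      using bl by simp
  qed
  {
    case Nil
    show ?case
    proof (cases w' rule: rev_cases)
      case (snoc v a)
      then show ?thesis using big[OF p' p, of v a] Nil by simp
    qed (use Nil in simp)
  next
    case (snoc a w)
    show ?case
    proof (cases w' rule: rev_cases)
      case Nil
      then show ?thesis using big[OF p p', of w a] snoc.prems by simp
    next
      case (snoc v a')
      let ?n = "p * b ^ length w + word_num b w"
      let ?n' = "p' * b ^ length v + word_num b v"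
      have lt: "a < b" "a' < b"
        using snoc snoc.prems A by auto
      have eq: "b * ?n + a = b * ?n' + a'"
        using snoc.prems(3) snoc by (simp add: word_num_snoc algebra_simps)
      have "a = a'"
        using arg_cong[OF eq, of "\<lambda>n. n mod b"] lt by simp
      moreover have "?n = ?n'"
        using eq lt \<open>a = a'\<close> by simp
      then have "p = p' \<and> w = v"
        using snoc.IH[of v] snoc.prems snoc by auto
      ultimately show ?thesis
        using snoc by simp
    qed
  }
qed

text \<open>
  The preimage of \<open>n\<close> is found by stripping last digits until the number drops below \<open>b ^ l\<close>; a
  number that is at least \<open>b ^ l\<close> stays at least \<open>b ^ (l - 1)\<close> after one more digit is stripped.
\<close>

lemma block_append_surj:
  assumes b: "b > 1" and l: "l \<ge> 1"
    and n: "n \<ge> b ^ (l - 1)" "admissible_nat b A n"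
  shows "\<exists>p\<in>admissible_block b A l. \<exists>w\<in>lists A. n = p * b ^ length w + word_num b w"
  using n
proof (induction n rule: less_induct)
  case (less n)
  show ?case
  proof (cases "n < b ^ l")
    case True
    then show ?thesis
      using less.prems by (intro bexI[of _ n] bexI[of _ "[]"]) (auto simp: admissible_block_def)
  next
    case False
    have "b * b ^ (l - 1) = b ^ l"
      using l by (cases l) auto
    then have ge: "n div b \<ge> b ^ (l - 1)"
      using False b by (metis div_le_mono nonzero_mult_div_cancel_left not_less not_one_less_zero)
    have "n > 0"
      using False b by (metis gr0I zero_less_power less_trans zero_less_one)
    then have adm: "n mod b \<in> A" "admissible_nat b A (n div b)"
      using admissible_nat_div_mod[OF b] less.prems by auto
    obtain p w where pw: "p \<in> admissible_block b A l" "w \<in> lists A"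
      "n div b = p * b ^ length w + word_num b w"
      using less.IH[of "n div b"] ge adm b \<open>n > 0\<close> by auto
    have "n = b * (n div b) + n mod b"
      by simp
    then have "n = p * b ^ length (w @ [n mod b]) + word_num b (w @ [n mod b])"
      unfolding pw(3) by (simp add: word_num_snoc algebra_simps)
    then show ?thesis
      using pw adm by (intro bexI[of _ p] bexI[of _ "w @ [n mod b]"]) auto
  qed
qed
section \<open>Summation over words by the first letter\<close>
lemma has_sum_sum:
  fixes f :: "'a \<Rightarrow> 'b \<Rightarrow> 'c :: topological_comm_monoid_add"
  assumes "\<And>i. i \<in> I \<Longrightarrow> (f i has_sum S i) A"
  shows "((\<lambda>x. \<Sum>i\<in>I. f i x) has_sum (\<Sum>i\<in>I. S i)) A"
  using assms by (induction I rule: infinite_finite_induct) (auto intro!: has_sum_add)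

text \<open>
  Splitting off the first letter shows that the sum \<open>S\<close> of \<open>g\<close> over words of bounded length
  satisfies \<open>S \<le> g [] + q * S + H\<close> up to a change of the length bound, where \<open>H\<close> is the sum of
  \<open>h\<close>.  Hence \<open>(g [] + H) / (1 - q)\<close> bounds all finite sums.
\<close>

lemma summable_on_lists_recursion:
  fixes g h :: "'a list \<Rightarrow> real"
  assumes A: "finite A" and q: "0 \<le> q" "q < 1"
    and g: "\<And>w. w \<in> lists A \<Longrightarrow> 0 \<le> g w" and h: "\<And>w. w \<in> lists A \<Longrightarrow> 0 \<le> h w"
    and hsum: "h summable_on lists A"
    and rec: "\<And>w. w \<in> lists A \<Longrightarrow> (\<Sum>a\<in>A. g (a # w)) \<le> q * g w + h w"
  shows "g summable_on lists A"
proof (rule nonneg_bdd_above_summable_on)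
  define W where "W k = {w \<in> lists A. length w < k}" for k
  define H where "H = infsum h (lists A)"
  define B where "B = (g [] + H) / (1 - q)"
  have fin: "finite (W k)" for k
    using finite_lists_length_le[OF A, of k] by (rule rev_finite_subset) (auto simp: W_def)
  have H: "sum h (W k) \<le> H" for k
    unfolding H_def using fin hsum h by (intro finite_sum_le_infsum) (auto simp: W_def)
  have H0: "0 \<le> H"
    unfolding H_def using h by (intro infsum_nonneg) auto
  have B0: "0 \<le> B"
    unfolding B_def using q H0 g[of "[]"] by auto
  have step: "W (Suc k) = insert [] ((\<lambda>(w, a). a # w) ` (W k \<times> A))" for k
  proof -
    have "w \<in> W (Suc k) \<longleftrightarrow> w \<in> insert [] ((\<lambda>(w, a). a # w) ` (W k \<times> A))" for w
      by (cases w) (auto simp: W_def image_iff)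
    then show ?thesis by blast
  qed
  have bound: "sum g (W k) \<le> B" for k
  proof (induction k)
    case 0
    then show ?case using B0 by (simp add: W_def)
  next
    case (Suc k)
    have "sum g (W (Suc k)) = g [] + sum g ((\<lambda>(w, a). a # w) ` (W k \<times> A))"
      unfolding step using fin A by (subst sum.insert) auto
    also have "sum g ((\<lambda>(w, a). a # w) ` (W k \<times> A)) = (\<Sum>(w, a)\<in>W k \<times> A. g (a # w))"
      by (subst sum.reindex) (auto simp: inj_on_def case_prod_unfold intro!: sum.cong)
    also have "\<dots> = (\<Sum>w\<in>W k. \<Sum>a\<in>A. g (a # w))"
      by (simp add: sum.cartesian_product)
    also have "\<dots> \<le> (\<Sum>w\<in>W k. q * g w + h w)"
      using rec by (intro sum_mono) (auto simp: W_def)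
    also have "\<dots> = q * sum g (W k) + sum h (W k)"
      by (simp add: sum.distrib sum_distrib_left)
    also have "\<dots> \<le> q * B + H"
      using Suc q H by (intro add_mono mult_left_mono) auto
    also have "g [] + (q * B + H) = B"
      using q by (simp add: B_def field_simps)
    finally show ?case by simp
  qed
  show "bdd_above (sum g ` {F. F \<subseteq> lists A \<and> finite F})"
  proof (rule bdd_aboveI2)
    fix F assume "F \<in> {F. F \<subseteq> lists A \<and> finite F}"
    then have F: "F \<subseteq> lists A" "finite F" by auto
    have "F \<subseteq> W (Suc (Max (length ` F)))"
      using F by (auto simp: W_def less_Suc_eq_le)
    then have "sum g F \<le> sum g (W (Suc (Max (length ` F))))"
      using fin g by (intro sum_mono2) (auto simp: W_def)
    with bound show "sum g F \<le> B"
      using order_trans by blast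
  qed
qed (use g in auto)

section \<open>Binomial coefficients and the binomial series\<close>

text \<open>
  In the integral form of the Taylor remainder, the factor \<open>(1 + t) powr (- s - M)\<close> has norm at
  most \<open>1\<close>, and the remaining integral of \<open>(y - t) ^ (M - 1) / fact (M - 1)\<close> is \<open>y ^ M / fact M\<close>.
  The bound is the norm of the first omitted term; it holds at \<open>y = 1\<close> and beyond, where absolute
  convergence of the binomial series may fail.
\<close>

lemma powr_neg_binomial_remainder_le:
  fixes s :: complex and y :: real
  assumes s: "Re s \<ge> 0" and y: "0 \<le> y"
  shows "norm ((1 + of_real y) powr (-s) - (\<Sum>m<M. ((-s) gchoose m) * of_real y ^ m))
           \<le> norm ((-s) gchoose M) * y ^ M"
proof (cases "M = 0")
  (* The integral form of the remainder requires M > 0. *)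
  case True
  have "norm ((1 + of_real y) powr (-s)) = (1 + y) powr (- Re s)"
    using y by (subst norm_powr_real_powr) auto
  also have "\<dots> \<le> (1 + y) powr 0"
    using s y by (intro powr_mono) auto
  finally show ?thesis using True y by simp
next
  case False
  define Df where "Df i t = fact i * ((-s) gchoose i) * (1 + of_real t) powr (-s - of_nat i)"
    for i and t :: real
  have Df: "(Df m has_vector_derivative Df (Suc m) t) (at t within {0..y})" if "0 \<le> t" for m t
  proof -
    have *: "((\<lambda>z. fact m * ((-s) gchoose m) * (1 + z) powr (-s - of_nat m)) has_field_derivative
            fact m * ((-s) gchoose m) * ((-s - of_nat m) * (1 + of_real t) powr (-s - of_nat m - 1)))
          (at (of_real t))"
      using that by (auto intro!: derivative_eq_intros simp: complex_nonpos_Reals_iff)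
    have eq: "fact (Suc m) * ((-s) gchoose Suc m) = fact m * ((-s) gchoose m) * (-s - of_nat m)"
      unfolding gbinomial_mult_fact by (simp add: prod.atLeast0_lessThan_Suc)
    have "Df (Suc m) t =
        fact m * ((-s) gchoose m) * ((-s - of_nat m) * (1 + of_real t) powr (-s - of_nat m - 1))"
      unfolding Df_def eq by (simp add: algebra_simps)
    with has_vector_derivative_real_field[OF *] show ?thesis
      unfolding Df_def by (metis (no_types, lifting) has_vector_derivative_at_within)
  qed
  define i where "i t = ((y - t) ^ (M - 1) / fact (M - 1)) *\<^sub>R Df M t" for t
  have int: "(i has_integral Df 0 y - (\<Sum>m<M. ((y - 0) ^ m / fact m) *\<^sub>R Df m 0)) {0..y}"
    unfolding i_def
    by (rule Taylor_has_integral) (use False y Df in auto)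
  let ?C = "norm ((-s) gchoose M)"
  have intb: "((\<lambda>t. fact M * ?C * ((y - t) ^ (M - 1) / fact (M - 1))) has_integral
      fact M * ?C * (y ^ M / fact M)) {0..y}"
  proof -
    have "((\<lambda>t. - ((y - t) ^ M / fact M)) has_vector_derivative (y - t) ^ (M - 1) / fact (M - 1))
        (at t within {0..y})" for t
      unfolding has_real_derivative_iff_has_vector_derivative[symmetric]
      using False fact_reduce[of M, where 'a = real]
      by (auto intro!: derivative_eq_intros simp: field_simps)
    then have "((\<lambda>t. (y - t) ^ (M - 1) / fact (M - 1)) has_integral
        (- ((y - y) ^ M / fact M) - (- ((y - 0) ^ M / fact M)))) {0..y}"
      by (intro fundamental_theorem_of_calculus y) auto
    then have "((\<lambda>t. (y - t) ^ (M - 1) / fact (M - 1)) has_integral (y ^ M / fact M)) {0..y}"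
      using False by (simp add: power_0_left)
    then show ?thesis
      by (rule has_integral_mult_right)
  qed
  have le: "norm (i t) \<le> fact M * ?C * ((y - t) ^ (M - 1) / fact (M - 1))" if "t \<in> {0..y}" for t
  proof -
    have "norm ((1 + of_real t) powr (-s - of_nat M)) = (1 + t) powr (- Re s - real M)"
      using that by (subst norm_powr_real_powr) auto
    also have "\<dots> \<le> (1 + t) powr 0"
      using s that by (intro powr_mono) auto
    finally have "norm (Df M t) \<le> fact M * ?C"
      unfolding Df_def norm_mult using that by (simp add: mult_left_le)
    then have "(y - t) ^ (M - 1) / fact (M - 1) * norm (Df M t) \<le>
        (y - t) ^ (M - 1) / fact (M - 1) * (fact M * ?C)"
      using that by (intro mult_left_mono) auto
    then show ?thesis
      unfolding i_def using that by (simp add: mult_ac)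
  qed
  have "norm (Df 0 y - (\<Sum>m<M. ((y - 0) ^ m / fact m) *\<^sub>R Df m 0)) \<le> fact M * ?C * (y ^ M / fact M)"
    using integral_norm_bound_integral[OF has_integral_integrable[OF int] has_integral_integrable[OF intb] le]
      integral_unique[OF int] integral_unique[OF intb] by simp
  moreover have "((y - 0) ^ m / fact m) *\<^sub>R Df m 0 = ((-s) gchoose m) * of_real y ^ m" for m
    by (simp add: Df_def scaleR_conv_of_real)
  ultimately show ?thesis
    by (simp add: Df_def)
qed

text \<open>
  This is the growth rate in the asymptotic formula \<open>1 / Gamma s * m powr (s - 1)\<close> for
  \<open>(- 1) ^ m * ((- s) gchoose m)\<close>.
\<close>

lemma norm_gbinomial_le_powr:
  fixes s :: complex
  shows "\<exists>C\<ge>0. \<forall>m>0. norm ((-s) gchoose m) \<le> C * real m powr (Re s - 1)"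
proof -
  let ?f = "\<lambda>n. ((-s) gchoose n) / ((-1) ^ n / exp ((-s + 1) * of_real (ln (real n))))"
  have "Bseq ?f"
    using gbinomial_asymptotic[of "-s"] by (intro convergent_imp_Bseq) (auto simp: convergent_def)
  then obtain C where C: "C > 0" "\<And>n. norm (?f n) \<le> C"
    by (auto simp: Bseq_def)
  have "norm ((-s) gchoose m) \<le> C * real m powr (Re s - 1)" if "m > 0" for m
  proof -
    have "norm (?f m) = norm ((-s) gchoose m) * real m powr (1 - Re s)"
      using that by (simp add: norm_divide norm_mult norm_power powr_def)
    with C(2)[of m] have "norm ((-s) gchoose m) * real m powr (1 - Re s) \<le> C"
      by simp
    then have "norm ((-s) gchoose m) * real m powr (1 - Re s) * real m powr (Re s - 1)
        \<le> C * real m powr (Re s - 1)"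
      by (intro mult_right_mono) auto
    then show ?thesis
      using that by (simp add: mult.assoc flip: powr_add)
  qed
  with C(1) show ?thesis
    by (intro exI[of _ C]) auto
qed

text \<open>
  These are norms of terms of the convergent binomial series of \<open>(1 + c) powr a\<close>.
\<close>

lemma gbinomial_mult_power_bounded:
  fixes a :: complex and c :: real
  assumes "0 \<le> c" "c < 1"
  shows "\<exists>C. \<forall>m. norm (a gchoose m) * c ^ m \<le> C"
proof -
  have "(\<lambda>n. (a gchoose n) * of_real 1 powr (a - of_nat n) * of_real c ^ n) sums of_real (1 + c) powr a"
    using assms by (intro gen_binomial_complex'') auto
  then have "summable (\<lambda>n. (a gchoose n) * of_real c ^ n)"
    by (simp add: sums_iff)
  then have "Bseq (\<lambda>n. (a gchoose n) * of_real c ^ n)"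
    by (intro convergent_imp_Bseq) (auto intro: convergentI dest: summable_LIMSEQ_zero)
  then obtain C where "\<And>n. norm ((a gchoose n) * of_real c ^ n) \<le> C"
    by (auto simp: Bseq_def)
  then show ?thesis
    using assms by (intro exI[of _ C]) (auto simp: norm_mult norm_power)
qed

text \<open>
  Large exponents only matter near \<open>x = 1\<close>: \<open>x ^ M \<le> exp (- y)\<close> with \<open>y = M * (1 - x)\<close>, and the
  exponential decays faster than any power of \<open>y\<close>.  This trades decay in \<open>M\<close> for a
  singularity at \<open>x = 1\<close>.
\<close>

lemma power_le_powr_neg:
  fixes x r :: real
  assumes x: "0 \<le> x" "x < 1" and r: "r > 0" and M: "M > 0"
  shows "x ^ M \<le> r powr r * real M powr (-r) * (1 - x) powr (-r)"
proof -
  define y where "y = real M * (1 - x)"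
  have y: "y > 0" using x M by (simp add: y_def)
  have "x \<le> exp (- (1 - x))"
    using exp_ge_add_one_self[of "- (1 - x)"] by simp
  then have "x ^ M \<le> exp (- (1 - x)) ^ M"
    using x by (intro power_mono) auto
  also have "\<dots> = exp (- y)"
    by (simp add: y_def algebra_simps flip: exp_of_nat_mult)
  also have "\<dots> \<le> r powr r * y powr (-r)"
  proof -
    have "ln (y / r) \<le> y / r"
      using ln_le_minus_one[of "y / r"] y r by simp
    then have "r * (ln y - ln r) \<le> y"
      using y r by (simp add: ln_div field_simps)
    then have "exp (- y) \<le> exp (r * ln r + (- r) * ln y)"
      by (simp add: algebra_simps)
    also have "\<dots> = r powr r * y powr (-r)"
      unfolding exp_add using y r by (simp add: powr_def)
    finally show ?thesis .
  qed
  also have "y powr (-r) = real M powr (-r) * (1 - x) powr (-r)"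
    by (simp add: y_def powr_mult)
  finally show ?thesis by (simp add: mult.assoc)
qed
section \<open>The measure on words and its moments\<close>
locale digit_measure =
  fixes b :: nat and A :: "nat set" and s :: complex
  assumes b: "b > 1" and A: "A \<subseteq> {0..<b}" and A_ne: "A \<noteq> {}"
    and s: "Re s > log (real b) (real (card A))"
begin

abbreviation mass :: "nat list \<Rightarrow> real" where
  "mass w \<equiv> real b powr (- Re s * real (length w))"

text \<open>
  The moments for the exponent \<open>Re s\<close>.  They dominate the moments for \<open>s\<close>, because \<open>mass\<close> is the
  absolute value of the complex mass.
\<close>

definition real_moment :: "nat \<Rightarrow> real" where
  "real_moment m = (\<Sum>\<^sub>\<infinity>w\<in>lists A. word_frac b w ^ m * mass w)"

lemma fin_A: "finite A"
  using A finite_subset by blast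

lemma card_A_less: "real (card A) < real b powr Re s"
proof -
  have "card A > 0"
    using fin_A A_ne by (simp add: card_gt_0_iff)
  then have "real (card A) = real b powr log (real b) (real (card A))"
    using b by simp
  also have "\<dots> < real b powr Re s"
    using b s by (intro powr_less_mono) auto
  finally show ?thesis .
qed

lemma Re_s_pos: "Re s > 0"
proof -
  have "card A \<ge> 1"
    using fin_A A_ne by (simp add: Suc_le_eq card_gt_0_iff)
  then have "0 \<le> log (real b) (real (card A))"
    using b by (intro zero_le_log_cancel_iff[THEN iffD2]) auto
  with s show ?thesis by simp
qed

lemma lists_words: "w \<in> lists A \<Longrightarrow> w \<in> words b"
  using A by (auto simp: words_def)

lemma word_frac_nonneg: "0 \<le> word_frac b w"
  by (simp add: word_frac_def)

lemma word_frac_less_1: "w \<in> lists A \<Longrightarrow> word_frac b w < 1"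
  using word_num_less[OF lists_words, of w] b
  by (simp add: word_frac_def flip: of_nat_power)

lemma word_frac_Cons: "word_frac b (a # w) = (real a + word_frac b w) / real b"
  using b by (simp add: word_frac_def word_num_Cons field_simps)

lemma mass_Cons: "mass (a # w) = real b powr (- Re s) * mass w"
  by (simp add: algebra_simps flip: powr_add)

text \<open>
  Each of the \<open>N\<close> admissible first digits contributes a factor \<open>b powr (- Re s)\<close>, and
  \<open>N * b powr (- Re s) < 1\<close> by the hypothesis on \<open>Re s\<close>.
\<close>

lemma mass_summable: "mass summable_on lists A"
proof (rule summable_on_lists_recursion[where h = "\<lambda>_. 0" and q = "real (card A) * real b powr (- Re s)"])
  show "real (card A) * real b powr (- Re s) < 1"
    using card_A_less b by (simp add: powr_minus field_simps)
  show "(\<Sum>a\<in>A. mass (a # w)) \<le> real (card A) * real b powr (- Re s) * mass w + 0" for w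
    unfolding mass_Cons by simp
qed (use fin_A in auto)

lemma real_moment_has_sum:
  "((\<lambda>w. word_frac b w ^ m * mass w) has_sum real_moment m) (lists A)"
proof -
  have "word_frac b w ^ m * mass w \<le> mass w" if "w \<in> lists A" for w
    using word_frac_nonneg word_frac_less_1[OF that] by (intro mult_left_le_one_le) (auto intro: power_le_one)
  then have "(\<lambda>w. word_frac b w ^ m * mass w) summable_on lists A"
    using word_frac_nonneg by (intro summable_on_comparison_test[OF mass_summable]) auto
  then show ?thesis
    unfolding real_moment_def by (rule has_sum_infsum)
qed

lemma real_moment_nonneg: "0 \<le> real_moment m"
  using word_frac_nonneg by (intro has_sum_nonneg[OF real_moment_has_sum]) auto

lemma norm_word_mass: "norm (of_nat b powr (- s * of_nat (length w))) = mass w"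
  by (subst norm_powr_real_powr) auto

lemma moment_has_sum:
  "((\<lambda>w. of_real (word_frac b w) ^ m * of_nat b powr (- s * of_nat (length w)))
     has_sum moment b A s m) (lists A)"
proof -
  have "(\<lambda>w. norm (of_real (word_frac b w) ^ m * of_nat b powr (- s * of_nat (length w)) :: complex))
      summable_on lists A"
    using real_moment_has_sum[of m, THEN has_sum_imp_summable] word_frac_nonneg
    unfolding norm_mult norm_power norm_word_mass by simp
  then have "(\<lambda>w. of_real (word_frac b w) ^ m * of_nat b powr (- s * of_nat (length w)) :: complex)
      summable_on lists A"
    by (rule abs_summable_summable)
  moreover have "moment b A s m =
      (\<Sum>\<^sub>\<infinity>w\<in>lists A. of_real (word_frac b w) ^ m * of_nat b powr (- s * of_nat (length w)))"
    unfolding moment_def word_mass_def admissible_word_def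
    by (rule infsum_cong_neutral) (use lists_words in auto)
  ultimately show ?thesis
    by (metis has_sum_infsum)
qed

lemma moment_real:
  assumes "s \<in> \<real>"
  shows "moment b A s m = of_real (real_moment m)"
proof -
  have s_eq: "s = of_real (Re s)"
    using assms by simp
  have "of_nat b powr (- s * of_nat (length w)) = (of_real (mass w) :: complex)" for w :: "nat list"
  proof -
    have "- s * of_nat (length w) = of_real (- Re s * real (length w))"
      by (subst s_eq) simp
    then have "of_nat b powr (- s * of_nat (length w)) =
        complex_of_real (real b) powr complex_of_real (- Re s * real (length w))"
      by (simp only: of_real_of_nat_eq)
    also have "\<dots> = of_real (mass w)"
      by (rule powr_of_real) simp
    finally show ?thesis .
  qed
  then have "((\<lambda>w. of_real (word_frac b w ^ m * mass w)) has_sum moment b A s m) (lists A)"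
    using moment_has_sum[of m] by (simp only: of_real_mult of_real_power)
  then show ?thesis
    using has_sum_of_real[OF real_moment_has_sum] by (rule has_sum_unique)
qed

text \<open>
  Summing over the first letter, the total mass \<open>u\<close> satisfies \<open>u = 1 + N * b powr (- s) * u\<close>.
\<close>

lemma moment_0: "moment b A s 0 = of_nat b powr s / (of_nat b powr s - of_nat (card A))"
proof -
  define f where "f w = (of_nat b powr (- s * of_nat (length w)) :: complex)" for w :: "nat list"
  let ?u = "moment b A s 0"
  have u: "(f has_sum ?u) (lists A)"
    using moment_has_sum[of 0] unfolding f_def[abs_def] by simp
  have "(f has_sum (of_nat b powr (- s) * ?u)) ((#) a ` lists A)" for a
  proof -
    have "((\<lambda>w. of_nat b powr (- s) * f w) has_sum (of_nat b powr (- s) * ?u)) (lists A)"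
      by (rule has_sum_cmult_right[OF u])
    then show ?thesis
      by (subst has_sum_reindex) (simp_all add: f_def o_def algebra_simps flip: powr_add)
  qed
  then have "(f has_sum (\<Sum>a\<in>A. of_nat b powr (- s) * ?u)) (\<Union>a\<in>A. (#) a ` lists A)"
    using fin_A by (intro sum_has_sum) auto
  then have "(f has_sum (f [] + (\<Sum>a\<in>A. of_nat b powr (- s) * ?u))) (insert [] (\<Union>a\<in>A. (#) a ` lists A))"
    by (intro has_sum_insert) auto
  moreover have "insert [] (\<Union>a\<in>A. (#) a ` lists A) = lists A"
  proof -
    have "w \<in> insert [] (\<Union>a\<in>A. (#) a ` lists A) \<longleftrightarrow> w \<in> lists A" for w
      by (cases w) auto
    then show ?thesis by blast
  qed
  ultimately have "?u = f [] + (\<Sum>a\<in>A. of_nat b powr (- s) * ?u)"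
    using u has_sum_unique by metis
  then have eq: "?u = 1 + of_nat (card A) * (?u / of_nat b powr s)"
    using b by (simp add: f_def powr_minus field_simps)
  have "norm (of_nat b powr s :: complex) = real b powr Re s"
    by (subst norm_powr_real_powr) auto
  then have "(of_nat b powr s :: complex) \<noteq> of_nat (card A)"
    using card_A_less by (metis norm_of_nat less_irrefl)
  with eq b show ?thesis
    by (simp add: field_simps)
qed

text \<open>
  It suffices to integrate the singularity \<open>(1 - x) powr (- r)\<close> over words.  Prepending the digit
  \<open>b - 1\<close> divides \<open>1 - x\<close> by \<open>b\<close>, which multiplies the weighted mass by \<open>b powr (r - Re s) < 1\<close>.
  Any other digit moves \<open>x\<close> at least \<open>1 / b\<close> away from \<open>1\<close>, so its contribution is bounded by a
  multiple of the mass itself.  The decay rate thus depends on \<open>Re s\<close> alone and not on the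
  number of digits.
\<close>

lemma real_moment_le_powr:
  assumes r: "0 < r" "r < Re s"
  shows "\<exists>C\<ge>0. \<forall>m>0. real_moment m \<le> C * real m powr (-r)"
proof -
  define g where "g w = mass w * (1 - word_frac b w) powr (-r)" for w
  have "g summable_on lists A"
  proof (rule summable_on_lists_recursion
      [where q = "real b powr (r - Re s)" and h = "\<lambda>w. real (card A) * (real b powr (r - Re s) * mass w)"])
    show "real b powr (r - Re s) < 1"
      using b r by (simp add: powr_less_one)
    show "(\<lambda>w. real (card A) * (real b powr (r - Re s) * mass w)) summable_on lists A"
      by (intro summable_on_cmult_right mass_summable)
    fix w assume w: "w \<in> lists A"
    let ?q = "real b powr (r - Re s)"
    have x: "0 \<le> word_frac b w" "word_frac b w < 1"
      using word_frac_nonneg word_frac_less_1[OF w] by auto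
    have g0: "g w \<ge> 0"
      by (simp add: g_def)
    have large: "g ((b - 1) # w) = ?q * g w"
    proof -
      have "1 - word_frac b ((b - 1) # w) = (1 - word_frac b w) / real b"
        using b by (simp add: word_frac_Cons field_simps of_nat_diff)
      then have "g ((b - 1) # w) = real b powr (- Re s) * mass w * ((1 - word_frac b w) powr (-r) * real b powr r)"
        unfolding g_def mass_Cons using x by (simp add: powr_divide powr_minus_divide)
      then show ?thesis
        by (simp add: g_def mult_ac powr_diff powr_minus_divide)
    qed
    have small: "g (a # w) \<le> ?q * mass w" if "a \<in> A" "a \<noteq> b - 1" for a
    proof -
      have "real a + 2 \<le> real b"
        using that A by fastforce
      then have "1 / real b \<le> 1 - word_frac b (a # w)"
        using x b by (simp add: word_frac_Cons field_simps)
      then have "(1 - word_frac b (a # w)) powr (-r) \<le> (1 / real b) powr (-r)"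
        using b r by (intro powr_mono2') auto
      also have "\<dots> = real b powr r"
        using b by (simp add: powr_divide powr_minus_divide)
      finally have "g (a # w) \<le> real b powr (- Re s) * mass w * real b powr r"
        unfolding g_def mass_Cons by (intro mult_left_mono) auto
      then show ?thesis
        by (simp add: mult_ac powr_diff powr_minus_divide)
    qed
    have "(\<Sum>a\<in>A. g (a # w)) \<le> (\<Sum>a\<in>A. (if a = b - 1 then ?q * g w else 0) + ?q * mass w)"
      using large small g0 by (intro sum_mono) auto
    also have "\<dots> = (if b - 1 \<in> A then ?q * g w else 0) + real (card A) * (?q * mass w)"
      using fin_A by (simp add: sum.distrib)
    also have "\<dots> \<le> ?q * g w + real (card A) * (?q * mass w)"
      using g0 by simp
    finally show "(\<Sum>a\<in>A. g (a # w)) \<le> ?q * g w + real (card A) * (?q * mass w)" .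
  qed (use fin_A in \<open>auto simp: g_def\<close>)
  then have g: "(g has_sum infsum g (lists A)) (lists A)"
    by (rule has_sum_infsum)
  have "real_moment m \<le> r powr r * infsum g (lists A) * real m powr (-r)" if m: "m > 0" for m
  proof -
    have "((\<lambda>w. r powr r * real m powr (-r) * g w) has_sum
        (r powr r * real m powr (-r) * infsum g (lists A))) (lists A)"
      by (rule has_sum_cmult_right[OF g])
    moreover have "word_frac b w ^ m * mass w \<le> r powr r * real m powr (-r) * g w"
      if "w \<in> lists A" for w
    proof -
      have "word_frac b w ^ m \<le> r powr r * real m powr (-r) * (1 - word_frac b w) powr (-r)"
        using power_le_powr_neg word_frac_nonneg word_frac_less_1[OF that] r m by blast
      then have "word_frac b w ^ m * mass w
          \<le> r powr r * real m powr (-r) * (1 - word_frac b w) powr (-r) * mass w"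
        by (intro mult_right_mono) auto
      then show ?thesis by (simp add: g_def mult_ac)
    qed
    ultimately have "real_moment m \<le> r powr r * real m powr (-r) * infsum g (lists A)"
      by (rule has_sum_mono[OF real_moment_has_sum])
    then show ?thesis by (simp add: mult_ac)
  qed
  moreover have "infsum g (lists A) \<ge> 0"
    by (intro infsum_nonneg) (simp add: g_def)
  ultimately show ?thesis
    by (intro exI[of _ "r powr r * infsum g (lists A)"]) auto
qed

text \<open>
  The first digit is at most \<open>b - 2\<close>, and the digits after it add less than \<open>1 / b\<close>.
\<close>

lemma word_frac_le_if_max_digit_notin:
  assumes "b - 1 \<notin> A" and w: "w \<in> lists A"
  shows "word_frac b w \<le> 1 - 1 / real b"
proof (cases w)
  case Nil
  then show ?thesis using b by (simp add: word_frac_def)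
next
  case (Cons a v)
  then have "real a + 2 \<le> real b"
    using w A assms by fastforce
  then have "(real a + word_frac b v) / real b \<le> (real b - 1) / real b"
    using word_frac_less_1[of v] w Cons by (intro divide_right_mono) auto
  then show ?thesis
    using b Cons by (simp add: word_frac_Cons diff_divide_distrib)
qed

lemma real_moment_le_power:
  assumes "\<And>w. w \<in> lists A \<Longrightarrow> word_frac b w \<le> d"
  shows "real_moment m \<le> d ^ m * real_moment 0"
proof (rule has_sum_mono[OF real_moment_has_sum])
  show "((\<lambda>w. d ^ m * (word_frac b w ^ 0 * mass w)) has_sum (d ^ m * real_moment 0)) (lists A)"
    by (rule has_sum_cmult_right[OF real_moment_has_sum])
  show "word_frac b w ^ m * mass w \<le> d ^ m * (word_frac b w ^ 0 * mass w)" if "w \<in> lists A" for w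
    using word_frac_nonneg assms[OF that] by (auto intro!: mult_right_mono power_mono)
qed

section \<open>Expansion of the sum with a fixed leading block\<close>

definition tail_sum :: "nat \<Rightarrow> complex" where
  "tail_sum p = (\<Sum>\<^sub>\<infinity>w\<in>lists A. 1 / of_nat (p * b ^ length w + word_num b w) powr s)"

text \<open>
  Appending \<open>w\<close> to \<open>p\<close> gives \<open>b ^ k * p * (1 + x / p)\<close>, where \<open>k\<close> is the length of \<open>w\<close> and \<open>x\<close> its
  fraction.
\<close>

lemma inverse_power_append:
  assumes p: "p > 0"
  shows "1 / of_nat (p * b ^ length w + word_num b w) powr s =
    1 / of_nat p powr s * of_nat b powr (- s * of_nat (length w)) *
      (1 + of_real (word_frac b w / real p)) powr (- s)"
proof -
  let ?x = "word_frac b w / real p"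
  have x: "0 \<le> ?x" by (simp add: word_frac_nonneg)
  have "(of_nat (p * b ^ length w + word_num b w) :: complex) =
      of_nat p * (of_real (real b ^ length w) * of_real (1 + ?x))"
  proof -
    have "real (p * b ^ length w + word_num b w) = real p * (real b ^ length w * (1 + ?x))"
      using p b by (simp add: word_frac_def field_simps)
    then have "complex_of_real (real (p * b ^ length w + word_num b w)) =
        complex_of_real (real p * (real b ^ length w * (1 + ?x)))"
      by (rule arg_cong)
    then show ?thesis
      by (simp only: of_real_mult of_real_of_nat_eq)
  qed
  then have "(of_nat (p * b ^ length w + word_num b w) :: complex) powr s =
      of_nat p powr s * (of_real (real b ^ length w) powr s * of_real (1 + ?x) powr s)"
    using x by (simp add: powr_times_real)
  also have "(of_real (real b ^ length w) powr s :: complex) = of_nat b powr (s * of_nat (length w))"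
    using b by (simp add: powr_def Ln_of_real' ln_realpow mult_ac flip: of_real_power)
  finally show ?thesis
    by (simp only: divide_inverse inverse_mult_distrib mult_1_left mult.assoc mult_minus_left
        powr_minus of_real_add of_real_1)
qed

lemma has_sum_tail_sum:
  assumes p: "p > 0"
  shows "((\<lambda>w. 1 / of_nat (p * b ^ length w + word_num b w) powr s) has_sum tail_sum p) (lists A)"
proof -
  have "norm (1 / of_nat (p * b ^ length w + word_num b w) powr s :: complex)
      \<le> norm (1 / of_nat p powr s :: complex) * mass w" for w
  proof -
    have le_1: "norm ((1 + of_real y) powr (- s) :: complex) \<le> 1" if "0 \<le> y" for y
      using powr_neg_binomial_remainder_le[of s y 0] Re_s_pos that by simp
    have "norm ((1 + of_real (word_frac b w / real p)) powr (- s) :: complex) \<le> 1"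
      by (rule le_1) (simp add: word_frac_nonneg)
    then show ?thesis
      unfolding inverse_power_append[OF p] norm_mult norm_word_mass
      by (rule mult_left_le) simp
  qed
  then have "(\<lambda>w. 1 / of_nat (p * b ^ length w + word_num b w) powr s :: complex) summable_on lists A"
    by (rule abs_summable_summable[OF Infinite_Sum.abs_summable_on_comparison_test'
          [OF summable_on_cmult_right[OF mass_summable]]])
  then show ?thesis
    unfolding tail_sum_def by (rule has_sum_infsum)
qed

text \<open>
  Integration of the binomial expansion in \<open>x / p\<close> over all words \<open>w\<close>.  Only finitely many terms
  are exchanged with the integral; the pointwise remainder bound is integrated instead of
  exchanging the full series, which need not converge absolutely.
\<close>

lemma tail_sum_remainder:
  assumes p: "p > 0"
  shows "norm (tail_sum p - (\<Sum>m<M. ((-s) gchoose m) * moment b A s m * (1 / of_nat p powr (of_nat m + s))))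
     \<le> norm ((-s) gchoose M) * real_moment M * real p powr (- Re s - real M)"
proof (rule norm_infsum_le)
  let ?B = "\<lambda>w. of_nat b powr (- s * of_nat (length w)) :: complex"
  let ?x = "word_frac b"
  let ?t = "\<lambda>w m. ((-s) gchoose m) * (of_real (?x w) ^ m * ?B w) * (1 / of_nat p powr (of_nat m + s))"
  show "((\<lambda>w. 1 / of_nat (p * b ^ length w + word_num b w) powr s - (\<Sum>m<M. ?t w m)) has_sum
      (tail_sum p - (\<Sum>m<M. ((-s) gchoose m) * moment b A s m * (1 / of_nat p powr (of_nat m + s))))) (lists A)"
  proof -
    have "((\<lambda>w. \<Sum>m<M. ?t w m) has_sum
        (\<Sum>m<M. ((-s) gchoose m) * moment b A s m * (1 / of_nat p powr (of_nat m + s)))) (lists A)"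
      by (intro has_sum_sum has_sum_cmult_left has_sum_cmult_right moment_has_sum)
    from has_sum_add[OF has_sum_tail_sum[OF p] has_sum_uminusI[OF this]] show ?thesis
      by simp
  qed
  show "((\<lambda>w. norm ((-s) gchoose M) * (?x w ^ M * mass w) * real p powr (- Re s - real M)) has_sum
     (norm ((-s) gchoose M) * real_moment M * real p powr (- Re s - real M))) (lists A)"
    by (intro has_sum_cmult_left has_sum_cmult_right real_moment_has_sum)
  fix w assume "w \<in> lists A"
  define y where "y = ?x w / real p"
  have y: "0 \<le> y" by (simp add: y_def word_frac_nonneg)
  have "?t w m = 1 / of_nat p powr s * ?B w * (((-s) gchoose m) * of_real y ^ m)" for m
    using p by (simp add: y_def powr_add power_divide mult_ac)
  then have "1 / of_nat (p * b ^ length w + word_num b w) powr s - (\<Sum>m<M. ?t w m) =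
      1 / of_nat p powr s * ?B w * ((1 + of_real y) powr (- s) - (\<Sum>m<M. ((-s) gchoose m) * of_real y ^ m))"
    unfolding inverse_power_append[OF p] y_def[symmetric]
    by (simp only: right_diff_distrib sum_distrib_left)
  also have "norm \<dots> \<le> norm (1 / of_nat p powr s :: complex) * mass w * (norm ((-s) gchoose M) * y ^ M)"
    unfolding norm_mult norm_word_mass
    using powr_neg_binomial_remainder_le[of s y M] Re_s_pos y by (intro mult_left_mono) auto
  also have "norm (1 / of_nat p powr s :: complex) = real p powr (- Re s)"
    unfolding norm_divide by (subst norm_powr_real_powr) (auto simp: powr_minus_divide)
  also have "real p powr (- Re s) * mass w * (norm ((-s) gchoose M) * y ^ M) =
      norm ((-s) gchoose M) * (?x w ^ M * mass w) * real p powr (- Re s - real M)"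
    using p by (simp add: y_def power_divide powr_diff powr_realpow)
  finally show "norm (1 / of_nat (p * b ^ length w + word_num b w) powr s - (\<Sum>m<M. ?t w m))
      \<le> norm ((-s) gchoose M) * (?x w ^ M * mass w) * real p powr (- Re s - real M)" .
qed

section \<open>The remainder of the series\<close>

lemma finite_admissible_block: "finite (admissible_block b A l)"
  by (rule finite_subset[of _ "{..<b ^ l}"]) (auto simp: admissible_block_def)

lemma admissible_block_pos: "p \<in> admissible_block b A l \<Longrightarrow> p > 0"
proof -
  have "0 < b ^ (l - 1)"
    using b by simp
  then show "p > 0" if "p \<in> admissible_block b A l"
    using that unfolding admissible_block_def by (metis (lifting) mem_Collect_eq order.strict_trans2)
qed

lemma restricted_zeta_split:
  assumes l: "l \<ge> 1"
  shows "restricted_zeta b A s =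
    (\<Sum>n\<in>{n. 0 < n \<and> n < b ^ (l - 1) \<and> admissible_nat b A n}. 1 / of_nat n powr s) +
    (\<Sum>p\<in>admissible_block b A l. tail_sum p)"
proof -
  let ?e = "\<lambda>p w. p * b ^ length w + word_num b w"
  let ?f = "\<lambda>n. 1 / of_nat n powr s :: complex"
  let ?S = "{n. 0 < n \<and> n < b ^ (l - 1) \<and> admissible_nat b A n}"
  let ?L = "\<Union>p\<in>admissible_block b A l. ?e p ` lists A"
  have inj: "p = p' \<and> w = w'"
    if "p \<in> admissible_block b A l" "p' \<in> admissible_block b A l" "w \<in> lists A" "w' \<in> lists A"
      "?e p w = ?e p' w'" for p p' w w'
    using block_append_inj[OF b l A that(1,2)] that(3-5) by blast
  have "(?f has_sum (\<Sum>p\<in>admissible_block b A l. tail_sum p)) ?L"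
  proof (rule sum_has_sum)
    fix p assume p: "p \<in> admissible_block b A l"
    have "inj_on (?e p) (lists A)"
      using inj[OF p p] by (intro inj_onI) blast
    then show "(?f has_sum tail_sum p) (?e p ` lists A)"
      using has_sum_tail_sum[OF admissible_block_pos[OF p]]
      by (subst has_sum_reindex) (auto simp: o_def)
  next
    fix p p' assume "p \<in> admissible_block b A l" "p' \<in> admissible_block b A l" "p \<noteq> p'"
    then show "?e p ` lists A \<inter> ?e p' ` lists A = {}"
      using inj by blast
  qed (rule finite_admissible_block)
  moreover have L: "?L = {n. b ^ (l - 1) \<le> n \<and> admissible_nat b A n}"
  proof (intro equalityI subsetI)
    fix n assume "n \<in> ?L"
    then obtain p w where "p \<in> admissible_block b A l" "w \<in> lists A" "n = ?e p w" by blast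
    then show "n \<in> {n. b ^ (l - 1) \<le> n \<and> admissible_nat b A n}"
      using ge_block_append[OF b] admissible_nat_append[OF b A] admissible_block_pos[of p l]
      by (auto simp: admissible_block_def)
  qed (use block_append_surj[OF b l] in blast)
  moreover have "(?f has_sum (\<Sum>n\<in>?S. ?f n)) ?S"
    by (rule has_sum_finite) simp
  moreover have "?S \<inter> ?L = {}"
    unfolding L by auto
  ultimately have "(?f has_sum ((\<Sum>n\<in>?S. ?f n) + (\<Sum>p\<in>admissible_block b A l. tail_sum p))) (?S \<union> ?L)"
    by (intro has_sum_Un_disjoint)
  also have "?S \<union> ?L = {n. 0 < n \<and> admissible_nat b A n}"
  proof -
    have "b ^ (l - 1) > 0" using b by simp
    have "n > 0" if "b ^ (l - 1) \<le> n" for n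
      by (rule less_le_trans[OF \<open>b ^ (l - 1) > 0\<close> that])
    then show ?thesis unfolding L by auto
  qed
  finally show ?thesis
    unfolding restricted_zeta_def by (rule infsumI)
qed

lemma sum_block_powr_le:
  assumes c: "1 \<le> c" and ge: "\<And>p. p \<in> admissible_block b A l \<Longrightarrow> c \<le> real p"
  shows "(\<Sum>p\<in>admissible_block b A l. real p powr (- Re s - real m))
    \<le> real (card (admissible_block b A l)) * (1 / c) ^ m"
proof -
  have "real p powr (- Re s - real m) \<le> (1 / c) ^ m" if "p \<in> admissible_block b A l" for p
  proof -
    have "real p powr (- Re s - real m) \<le> real p powr (- real m)"
      using ge[OF that] c Re_s_pos by (intro powr_mono) auto
    also have "\<dots> \<le> c powr (- real m)"
      using ge[OF that] c by (intro powr_mono2') auto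
    also have "\<dots> = (1 / c) ^ m"
      using c by (simp add: powr_minus_divide powr_realpow power_divide)
    finally show ?thesis .
  qed
  then have "(\<Sum>p\<in>admissible_block b A l. real p powr (- Re s - real m)) \<le>
      (\<Sum>p\<in>admissible_block b A l. (1 / c) ^ m)"
    by (rule sum_mono)
  then show ?thesis
    by simp
qed

definition remainder :: "nat \<Rightarrow> nat \<Rightarrow> complex" where
  "remainder l M = (\<Sum>p\<in>admissible_block b A l. tail_sum p) - (\<Sum>m<M. series_term b A s l m)"

lemma series_term_gbinomial:
  "series_term b A s l m =
    (\<Sum>p\<in>admissible_block b A l. ((-s) gchoose m) * moment b A s m * (1 / of_nat p powr (of_nat m + s)))"
  by (simp add: series_term_def gbinomial_pochhammer sum_distrib_left)

text \<open>
  For real \<open>s\<close> this is the absolute value of the \<open>m\<close>-th term of the series; for complex \<open>s\<close> it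
  dominates that term.
\<close>

definition majorant :: "nat \<Rightarrow> nat \<Rightarrow> real" where
  "majorant l m = norm ((-s) gchoose m) * real_moment m *
     (\<Sum>p\<in>admissible_block b A l. real p powr (- Re s - real m))"

lemma norm_remainder_le:
  "norm (remainder l M) \<le> majorant l M"
proof -
  have "remainder l M = (\<Sum>p\<in>admissible_block b A l. tail_sum p -
      (\<Sum>m<M. ((-s) gchoose m) * moment b A s m * (1 / of_nat p powr (of_nat m + s))))"
    unfolding remainder_def series_term_gbinomial sum_subtractf
    by (subst sum.swap) simp
  also have "norm \<dots> \<le> (\<Sum>p\<in>admissible_block b A l.
      norm ((-s) gchoose M) * real_moment M * real p powr (- Re s - real M))"
    by (intro sum_norm_le tail_sum_remainder admissible_block_pos)
  finally show ?thesis
    by (simp add: majorant_def sum_distrib_left)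
qed

text \<open>
  The coefficients are \<open>O(m powr (Re s - 1))\<close> and the moments are \<open>O(m powr (e - Re s))\<close> for any
  small \<open>e > 0\<close>, so the majorant is \<open>O(m powr (e - 1))\<close>.  The worst case is the leading
  block \<open>p = 1\<close>, where \<open>x / p\<close> may come arbitrarily close to \<open>1\<close>.
\<close>

lemma remainder_tendsto_0: "remainder l \<longlonglongrightarrow> 0"
proof -
  define e where "e = min (1 / 2) (Re s / 2)"
  (* e < 1 makes the majorant tend to 0, and e < Re s makes the decay exponent Re s - e positive. *)
  have e: "0 < e" "e < 1" "e < Re s"
    using Re_s_pos by (auto simp: e_def)
  obtain C where C: "C \<ge> 0" "\<And>m. m > 0 \<Longrightarrow> real_moment m \<le> C * real m powr (-(Re s - e))"
    using real_moment_le_powr[of "Re s - e"] e by auto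
  obtain D where D: "D \<ge> 0" "\<And>m. m > 0 \<Longrightarrow> norm ((-s) gchoose m) \<le> D * real m powr (Re s - 1)"
    using norm_gbinomial_le_powr[of s] by auto
  let ?K = "real (card (admissible_block b A l))"
  have bound: "norm (remainder l m) \<le> D * C * ?K * real m powr (e - 1)" if m: "m > 0" for m
  proof -
    have "(\<Sum>p\<in>admissible_block b A l. real p powr (- Re s - real m)) \<le> ?K"
      using sum_block_powr_le[of 1 l m] admissible_block_pos[of _ l] by (simp add: Suc_le_eq)
    then have "norm (remainder l m) \<le>
        (D * real m powr (Re s - 1)) * (C * real m powr (-(Re s - e))) * ?K"
      using C D m real_moment_nonneg
      by (intro order_trans[OF norm_remainder_le[unfolded majorant_def]] mult_mono) (auto intro: sum_nonneg)
    also have "\<dots> = D * C * ?K * (real m powr (Re s - 1) * real m powr (-(Re s - e)))"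
      by (simp add: mult_ac)
    also have "real m powr (Re s - 1) * real m powr (-(Re s - e)) = real m powr (e - 1)"
      by (simp flip: powr_add)
    finally show ?thesis .
  qed
  have "(\<lambda>m. real m powr (e - 1)) \<longlonglongrightarrow> 0"
    using e by (intro tendsto_neg_powr filterlim_real_sequentially) auto
  then have "(\<lambda>m. D * C * ?K * real m powr (e - 1)) \<longlonglongrightarrow> 0"
    by (intro tendsto_mult_right_zero)
  then show ?thesis
    by (rule Lim_null_comparison[rotated]) (use bound in \<open>auto intro!: eventually_mono[OF eventually_gt_at_top[of 0]]\<close>)
qed

lemma series_sums: "series_term b A s l sums (\<Sum>p\<in>admissible_block b A l. tail_sum p)"
proof -
  have "(\<lambda>M. (\<Sum>p\<in>admissible_block b A l. tail_sum p) - remainder l M)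
      \<longlonglongrightarrow> (\<Sum>p\<in>admissible_block b A l. tail_sum p) - 0"
    by (intro tendsto_intros remainder_tendsto_0)
  then show ?thesis
    by (simp add: sums_def remainder_def)
qed

lemma leading_terms_eq:
  "leading_terms b A s l =
    (\<Sum>n\<in>{n. 0 < n \<and> n < b ^ (l - 1) \<and> admissible_nat b A n}. 1 / of_nat n powr s) +
    series_term b A s l 0"
  by (simp add: leading_terms_def series_term_def moment_0)

lemma leading_terms_plus_partial_sum:
  assumes "l \<ge> 1"
  shows "leading_terms b A s l + (\<Sum>m=1..M. series_term b A s l m) =
    restricted_zeta b A s - remainder l (Suc M)"
proof -
  have "(\<Sum>m<Suc M. series_term b A s l m) = series_term b A s l 0 + (\<Sum>m=1..M. series_term b A s l m)"
    by (simp add: sum.atMost_shift sum.shift_bounds_Suc_ivl lessThan_Suc_atMost sum.atLeast1_atMost_eq)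
  then show ?thesis
    by (simp add: leading_terms_eq restricted_zeta_split[OF assms] remainder_def)
qed

lemma series_Suc_sums:
  assumes "l \<ge> 1"
  shows "(\<lambda>m. series_term b A s l (Suc m)) sums (restricted_zeta b A s - leading_terms b A s l)"
  using series_sums[of l] by (simp add: sums_Suc_iff leading_terms_eq restricted_zeta_split[OF assms])

section \<open>Enclosure for real exponents\<close>

lemma series_term_real:
  assumes "s \<in> \<real>"
  shows "series_term b A s l m = of_real ((- 1) ^ m * majorant l m)"
proof -
  have s_eq: "s = of_real (Re s)"
    using assms by simp
  have "(-s) gchoose m = of_real ((- 1) ^ m * (pochhammer (Re s) m / fact m))"
    by (subst s_eq) (simp add: gbinomial_pochhammer flip: pochhammer_of_real)
  moreover from this have "norm ((-s) gchoose m) = pochhammer (Re s) m / fact m"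
    using Re_s_pos by (simp only: norm_of_real) (simp add: abs_mult power_abs pochhammer_nonneg)
  ultimately have c: "(-s) gchoose m = of_real ((- 1) ^ m * norm ((-s) gchoose m))"
    by simp
  have p: "1 / of_nat p powr (of_nat m + s) = (of_real (real p powr (- Re s - real m)) :: complex)" for p
  proof -
    have "of_nat m + s = of_real (real m + Re s)"
      using s_eq by simp
    then have "of_nat p powr (of_nat m + s) = (of_real (real p powr (real m + Re s)) :: complex)"
      using powr_of_real[of "real p" "real m + Re s"] by simp
    moreover have "- Re s - real m = - (real m + Re s)"
      by simp
    then have "real p powr (- Re s - real m) = 1 / real p powr (real m + Re s)"
      by (simp only: powr_minus_divide)
    ultimately show ?thesis by simp
  qed
  show ?thesis
    unfolding series_term_gbinomial p moment_real[OF assms]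
    by (subst c) (simp add: majorant_def sum_distrib_left mult_ac)
qed

text \<open>
  A remainder is at most as large as its first term in absolute value, so what is left after
  subtracting that term is zero or has the opposite sign.
\<close>

lemma remainder_sign:
  assumes "s \<in> \<real>"
  shows "even M \<Longrightarrow> Re (remainder l (Suc M)) \<le> 0" "odd M \<Longrightarrow> Re (remainder l (Suc M)) \<ge> 0"
proof -
  have "\<bar>Re (remainder l M)\<bar> \<le> majorant l M"
    using abs_Re_le_cmod norm_remainder_le order_trans by blast
  moreover have "Re (remainder l (Suc M)) = Re (remainder l M) - (- 1) ^ M * majorant l M"
    by (simp add: remainder_def series_term_real[OF assms] del: of_real_mult)
  ultimately show "even M \<Longrightarrow> Re (remainder l (Suc M)) \<le> 0" "odd M \<Longrightarrow> Re (remainder l (Suc M)) \<ge> 0"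
    by auto
qed

lemma series_term_in_Reals: "s \<in> \<real> \<Longrightarrow> series_term b A s l m \<in> \<real>"
  unfolding series_term_real by (rule Reals_of_real)

lemma leading_terms_in_Reals:
  assumes "s \<in> \<real>"
  shows "leading_terms b A s l \<in> \<real>"
proof -
  have "s = of_real (Re s)"
    using assms by simp
  then have "of_nat n powr s = (of_real (real n powr Re s) :: complex)" for n
    using powr_of_real[of "real n" "Re s"] by simp
  then show ?thesis
    unfolding leading_terms_eq using series_term_in_Reals[OF assms] by (auto intro!: Reals_add sum_in_Reals)
qed

lemma restricted_zeta_in_Reals:
  assumes "s \<in> \<real>"
  shows "restricted_zeta b A s \<in> \<real>"
proof -
  have "restricted_zeta b A s - leading_terms b A s 1 \<in> \<real>"
  proof (rule closed_sequentially[OF closed_complex_Reals])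
    show "(\<Sum>m<n. series_term b A s 1 (Suc m)) \<in> \<real>" for n
      using series_term_in_Reals[OF assms] by (intro sum_in_Reals)
    show "(\<lambda>n. \<Sum>m<n. series_term b A s 1 (Suc m)) \<longlonglongrightarrow> restricted_zeta b A s - leading_terms b A s 1"
      using series_Suc_sums[of 1] by (simp add: sums_def)
  qed
  from Reals_add[OF this leading_terms_in_Reals[OF assms, of 1]] show ?thesis
    by simp
qed

section \<open>Geometric convergence\<close>

lemma suminf_series_Suc_tail:
  assumes "l \<ge> 1"
  shows "(\<Sum>m. series_term b A s l (Suc (m + M))) = remainder l (Suc M)"
proof -
  have "(\<lambda>m. series_term b A s l (m + Suc M)) sums remainder l (Suc M)"
    unfolding remainder_def using series_sums[of l] by (subst sums_iff_shift')
  then show ?thesis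
    by (simp add: sums_iff)
qed

text \<open>
  Here \<open>x / p \<le> d / c < 1\<close> for all words and leading blocks, so the majorant is at most a constant
  times \<open>norm ((- s) gchoose m) * (d / c) ^ m\<close>.  One factor \<open>sqrt (d / c) ^ m\<close> is spent on the growth of
  the binomial coefficient, the other one gives the geometric rate.
\<close>

lemma geometrically_convergent_if_frac_bound:
  assumes l: "l \<ge> 1" and c: "1 \<le> c" and d: "0 < d" "d < c"
    and ge: "\<And>p. p \<in> admissible_block b A l \<Longrightarrow> c \<le> real p"
    and le: "\<And>w. w \<in> lists A \<Longrightarrow> word_frac b w \<le> d"
  shows "geometrically_convergent (\<lambda>m. series_term b A s l (Suc m))"
proof -
  define q where "q = sqrt (d / c)"
  have q: "0 < q" "q < 1" "q * q = d / c"
    using c d by (auto simp: q_def)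
  define C where "C = real_moment 0 * real (card (admissible_block b A l))"
  have C: "0 \<le> C"
    using real_moment_nonneg by (simp add: C_def)
  obtain D where D: "\<And>m. norm ((-s) gchoose m) * q ^ m \<le> D"
    using gbinomial_mult_power_bounded[of q "-s"] q by auto
  have majorant: "majorant l m \<le> D * C * q ^ m" for m
  proof -
    have "real_moment m * (\<Sum>p\<in>admissible_block b A l. real p powr (- Re s - real m)) \<le>
        (d ^ m * real_moment 0) * (real (card (admissible_block b A l)) * (1 / c) ^ m)"
      using real_moment_le_power[OF le] sum_block_powr_le[OF c ge] real_moment_nonneg d
      by (intro mult_mono) (auto intro: sum_nonneg)
    also have "\<dots> = C * (d / c) ^ m"
      by (simp add: C_def power_divide)
    also have "\<dots> = C * (q ^ m * q ^ m)"
      by (simp add: q(3) flip: power_mult_distrib)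
    finally have "majorant l m \<le> norm ((-s) gchoose m) * (C * (q ^ m * q ^ m))"
      unfolding majorant_def mult.assoc by (intro mult_left_mono) auto
    also have "\<dots> = norm ((-s) gchoose m) * q ^ m * (C * q ^ m)"
      by (simp add: mult_ac)
    also have "\<dots> \<le> D * (C * q ^ m)"
      using D C q by (intro mult_right_mono) auto
    finally show ?thesis
      by (simp add: mult.assoc)
  qed
  have "norm (remainder l (Suc M)) \<le> D * C * q * norm (complex_of_real (q ^ M))" for M
    using order_trans[OF norm_remainder_le[of l "Suc M"] majorant] q by (simp add: norm_power mult_ac)
  then have "(\<lambda>M. remainder l (Suc M)) \<in> O(\<lambda>M. of_real (q ^ M))"
    by (intro bigoI) (auto intro!: always_eventually)
  then show ?thesis
    unfolding geometrically_convergent_def suminf_series_Suc_tail[OF l]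
    using series_Suc_sums[OF l] q by (auto simp: sums_iff)
qed

lemma admissible_block_ge_2:
  assumes "l > 1 \<or> l = 1 \<and> 1 \<notin> A" and p: "p \<in> admissible_block b A l"
  shows "p \<ge> 2"
proof (cases "l > 1")
  case True
  have "b ^ 1 \<le> b ^ (l - 1)"
    using True b by (intro power_increasing) auto
  then show ?thesis
    using p b by (auto simp: admissible_block_def)
next
  case False
  then have "1 \<notin> A" using assms by auto
  moreover have "1 mod b \<in> A" if "admissible_nat b A 1"
    using that admissible_nat_div_mod[OF b, of 1 A] by simp
  ultimately have "p \<noteq> 1"
    using p b by (auto simp: admissible_block_def)
  then show ?thesis
    using admissible_block_pos[OF p] by simp
qed

end

section \<open>The series for the restricted zeta value\<close>

theorem theorem2p12:
  fixes b l :: nat and A :: "nat set" and s :: complex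
  assumes "b > 1"
    and "A \<subseteq> {0..<b}" and "A \<noteq> {}" and "A \<noteq> {0}"
    and "Re s > log (real b) (real (card A))"
    and "l \<ge> 1"
  shows "summable (\<lambda>m. series_term b A s l (Suc m))
    \<and> restricted_zeta b A s = leading_terms b A s l + (\<Sum>m. series_term b A s l (Suc m))
    \<and> (s \<in> \<real> \<longrightarrow>
         restricted_zeta b A s \<in> \<real> \<and>
         (\<forall>M. leading_terms b A s l + (\<Sum>m=1..M. series_term b A s l m) \<in> \<real> \<and>
            (even M \<longrightarrow> Re (restricted_zeta b A s)
               \<le> Re (leading_terms b A s l + (\<Sum>m=1..M. series_term b A s l m))) \<and>
            (odd M \<longrightarrow> Re (leading_terms b A s l + (\<Sum>m=1..M. series_term b A s l m))
               \<le> Re (restricted_zeta b A s))))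
    \<and> (l > 1 \<or> (l = 1 \<and> 1 \<notin> A) \<or> (l = 1 \<and> b - 1 \<notin> A) \<longrightarrow>
         geometrically_convergent (\<lambda>m. series_term b A s l (Suc m)))"
proof -
  interpret digit_measure b A s
    by unfold_locales (use assms in auto)
  note l = \<open>l \<ge> 1\<close>
  have "leading_terms b A s l + (\<Sum>m=1..M. series_term b A s l m) \<in> \<real>" if "s \<in> \<real>" for M
    using that by (intro Reals_add sum_in_Reals leading_terms_in_Reals series_term_in_Reals)
  moreover have "geometrically_convergent (\<lambda>m. series_term b A s l (Suc m))"
    if "l > 1 \<or> (l = 1 \<and> 1 \<notin> A) \<or> (l = 1 \<and> b - 1 \<notin> A)"
  proof (cases "l > 1 \<or> l = 1 \<and> 1 \<notin> A")
    case True
    then show ?thesis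
      using geometrically_convergent_if_frac_bound[OF l, of 2 1] admissible_block_ge_2 word_frac_less_1
      by (simp add: less_imp_le)
  next
    case False
    then have "b - 1 \<notin> A"
      using that by blast
    then show ?thesis
      using geometrically_convergent_if_frac_bound[OF l, of 1 "1 - 1 / real b"] b
        admissible_block_pos[of _ l] word_frac_le_if_max_digit_notin by (simp add: Suc_le_eq)
  qed
  ultimately show ?thesis
    using series_Suc_sums[OF l] restricted_zeta_in_Reals remainder_sign[of _ l]
    unfolding leading_terms_plus_partial_sum[OF l] by (auto simp: sums_iff)
qed

end
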